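(* Let $-\infty<p_1<p_2<+\infty$ and $\mu\in(0,1)$, and suppose that $u_0$ satisfies Condition ($C_{p_1,p_2,\mu}$) (see context). Let $u$ be the solution of the free Schrödinger equation $[i\partial_t+\partial_x^2]u=0$ on the line with $u(0,\cdot)=u_0$. Fix $\delta\in\big[\frac{\mu+1}{2},1\big)$ and $\varepsilon\in\big(0,\delta-\frac12\big)$. Let $\mathfrak{R}_\varepsilon$ be the set of $(t,x)\in(0,+\infty)\times\mathbb{R}$ such that $$\frac{x}{2t}-p_1\geqslant t^{-\varepsilon},\qquad x<2p_2\,t,\qquad t>T_{p_2}:=(p_2-p_1)^{-\frac1\varepsilon}.$$ Then there exist constants $C_{\mu>1/2}(u_0),C_{\mu=1/2}(u_0),C_{\mu<1/2}(u_0)>0$ such that for all $(t,x)\in\mathfrak{R}_\varepsilon$: - if $\mu>\frac12$: $\;|u(t,x)|\leqslant C_{\mu>1/2}(u_0)\,t^{-\frac12+\varepsilon(1-\mu)}$; - if $\mu=\frac12$: $\;|u(t,x)|\leqslant C_{\mu=1/2}(u_0)\,t^{-\frac12+\frac{\varepsilon}{2}}$; - if $\mu<\frac12$: $\;|u(t,x)|\leqslant C_{\mu<1/2}(u_0)\,t^{-\mu+\varepsilon\mu}$.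
   Context: $\mathcal{F}u_0$ denotes the Fourier transform of $u_0$, normalized so that the solution of the free Schrödinger equation is $$u(t,x)=\frac{1}{2\pi}\int_{p_1}^{p_2}\mathcal{F}u_0(p)\,e^{-itp^2+ixp}\,dp,\qquad t\geqslant0,\ x\in\mathbb{R}.$$ Condition ($C_{p_1,p_2,\mu}$): $\mathcal{F}u_0\equiv0$ on $\mathbb{R}\setminus[p_1,p_2]$, and $\mathcal{F}u_0(p)=(p-p_1)^{\mu-1}\tilde u(p)$ for $p\in(p_1,p_2]$, where $\tilde u\in\mathcal{C}^1([p_1,p_2],\mathbb{C})$, $\tilde u(p_1)\neq0$, and $\mathcal{F}u_0(p_2)=0$. *)

theory Defs
  imports "HOL-Probability.Characteristic_Functions"
begin

text \<open>
  The symbol may behave like \<open>(p - p1) powr (\<mu> - 1)\<close>, which is integrable but, for \<open>\<mu> \<le> 1/2\<close>, not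
  square integrable. The initial datum is then a bounded smooth function which in general lies
  neither in \<open>L\<^sup>1\<close> nor in \<open>L\<^sup>2\<close>, so its Fourier transform has to be taken in the sense of tempered
  distributions. The normalisation is \<open>F u(p) = \<integral> u(x) exp (- \<i> p x) dx\<close>.
\<close>

definition schwartz :: "(real \<Rightarrow> complex) \<Rightarrow> bool" where
  "schwartz \<phi> \<longleftrightarrow> (\<exists>D :: nat \<Rightarrow> real \<Rightarrow> complex. D 0 = \<phi> \<and>
     (\<forall>n x. (D n has_vector_derivative D (Suc n) x) (at x)) \<and>
     (\<forall>n k. bounded (range (\<lambda>x. of_real (x ^ k) * D n x))))"

definition fourier_L1 :: "(real \<Rightarrow> complex) \<Rightarrow> real \<Rightarrow> complex" where
  "fourier_L1 \<phi> x = (LINT p|lborel. \<phi> p * exp (- \<i> * of_real (p * x)))"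

definition tempered_function :: "(real \<Rightarrow> complex) \<Rightarrow> bool" where
  "tempered_function v \<longleftrightarrow> (\<exists>N::nat. integrable lborel (\<lambda>x. v x / of_real ((1 + \<bar>x\<bar>) ^ N)))"

definition has_fourier_transform :: "(real \<Rightarrow> complex) \<Rightarrow> (real \<Rightarrow> complex) \<Rightarrow> bool" where
  "has_fourier_transform v g \<longleftrightarrow> tempered_function v \<and> tempered_function g \<and>
     (\<forall>\<phi>. schwartz \<phi> \<longrightarrow>
        (LINT p|lborel. g p * \<phi> p) = (LINT x|lborel. v x * fourier_L1 \<phi> x))"

text \<open>Continuous differentiability on a closed interval, one-sided at the endpoints; the library's
  \<open>C1_differentiable_on\<close> asks for two-sided derivatives there.\<close>

definition C1_on_interval :: "real \<Rightarrow> real \<Rightarrow> (real \<Rightarrow> complex) \<Rightarrow> bool" where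
  "C1_on_interval a b v \<longleftrightarrow> (\<exists>v'. continuous_on {a..b} v' \<and>
     (\<forall>p\<in>{a..b}. (v has_vector_derivative v' p) (at p within {a..b})))"

text \<open>The condition on \<open>g = F u0\<close>; the value at the singular point \<open>p1\<close> is left free.\<close>

definition condition_C :: "real \<Rightarrow> real \<Rightarrow> real \<Rightarrow> (real \<Rightarrow> complex) \<Rightarrow> bool" where
  "condition_C p1 p2 \<mu> g \<longleftrightarrow>
     (\<forall>p. p \<notin> {p1..p2} \<longrightarrow> g p = 0) \<and>
     (\<exists>v. C1_on_interval p1 p2 v \<and> v p1 \<noteq> 0 \<and>
        (\<forall>p\<in>{p1<..p2}. g p = of_real ((p - p1) powr (\<mu> - 1)) * v p)) \<and>
     g p2 = 0"

definition solves_free_schrodinger ::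
    "(real \<Rightarrow> complex) \<Rightarrow> (real \<Rightarrow> real \<Rightarrow> complex) \<Rightarrow> bool" where
  "solves_free_schrodinger u0 u \<longleftrightarrow>
     (\<exists>ut ux uxx. \<forall>t>0. \<forall>x.
        ((\<lambda>s. u s x) has_vector_derivative ut t x) (at t) \<and>
        (u t has_vector_derivative ux t x) (at x) \<and>
        (ux t has_vector_derivative uxx t x) (at x) \<and>
        \<i> * ut t x + uxx t x = 0) \<and>
     continuous_on ({0..} \<times> UNIV) (\<lambda>(t, x). u t x) \<and>
     (\<forall>x. u 0 x = u0 x)"

definition schrodinger_integral ::
    "real \<Rightarrow> real \<Rightarrow> (real \<Rightarrow> complex) \<Rightarrow> real \<Rightarrow> real \<Rightarrow> complex" where
  "schrodinger_integral p1 p2 g t x =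
     1 / (2 * of_real pi) *
       (LINT p:{p1..p2}|lborel. g p * exp (- \<i> * of_real (t * p\<^sup>2) + \<i> * of_real (x * p)))"

definition region :: "real \<Rightarrow> real \<Rightarrow> real \<Rightarrow> (real \<times> real) set" where
  "region p1 p2 \<epsilon> = {(t, x). t > 0 \<and>
     x / (2 * t) - p1 \<ge> t powr (- \<epsilon>) \<and> x < 2 * p2 * t \<and> t > (p2 - p1) powr (- 1 / \<epsilon>)}"

text \<open>Under the condition above the integral formula is indeed a solution of the equation.\<close>

lemma integrable_mult_bounded:
  fixes h k :: "real \<Rightarrow> complex"
  assumes h: "integrable lborel h" and k: "k \<in> borel_measurable borel"
    and B: "\<And>p. h p \<noteq> 0 \<Longrightarrow> norm (k p) \<le> B"
  shows "integrable lborel (\<lambda>p. h p * k p)"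
proof (rule Bochner_Integration.integrable_bound)
  show "integrable lborel (\<lambda>p. B *\<^sub>R h p)" using h by simp
  show "(\<lambda>p. h p * k p) \<in> borel_measurable lborel"
    using borel_measurable_integrable[OF h] k by simp
  show "AE p in lborel. norm (h p * k p) \<le> norm (B *\<^sub>R h p)"
  proof (intro AE_I2)
    fix p
    show "norm (h p * k p) \<le> norm (B *\<^sub>R h p)"
    proof (cases "h p = 0")
      case False
      then have "norm (k p) \<le> \<bar>B\<bar>" using B[of p] by linarith
      then show ?thesis by (simp add: norm_mult mult.commute[of "\<bar>B\<bar>"] mult_left_mono)
    qed simp
  qed
qed

lemma oscillatory_has_vector_derivative:
  fixes h :: "real \<Rightarrow> complex" and w :: "real \<Rightarrow> real"
  assumes h: "integrable lborel h" and w[measurable]: "w \<in> borel_measurable borel"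
    and W: "\<And>p. h p \<noteq> 0 \<Longrightarrow> \<bar>w p\<bar> \<le> W"
  shows "((\<lambda>s. LINT p|lborel. h p * iexp (s * w p)) has_vector_derivative
           (LINT p|lborel. h p * (\<i> * w p * iexp (s * w p)))) (at s)"
    (is "(?g has_vector_derivative ?g') _")
proof -
  define K where "K = (LINT p|lborel. norm (h p)) * W\<^sup>2 / 2"
  have i1: "integrable lborel (\<lambda>p. h p * iexp (s * w p))" for s
    by (rule integrable_mult_bounded[OF h, where B = 1]) auto
  have i2: "integrable lborel (\<lambda>p. h p * (\<i> * w p * iexp (s * w p)))"
    by (rule integrable_mult_bounded[OF h, where B = W]) (auto simp: norm_mult W)
  have bound: "norm (?g y - ?g s - (y - s) *\<^sub>R ?g') \<le> K * \<bar>y - s\<bar>\<^sup>2" for y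
  proof -
    have split: "?g y - ?g s - (y - s) *\<^sub>R ?g' =
      (LINT p|lborel. h p * iexp (y * w p) - h p * iexp (s * w p)
         - (y - s) *\<^sub>R (h p * (\<i> * w p * iexp (s * w p))))"
      using i1 i2 by simp
    have "norm (?g y - ?g s - (y - s) *\<^sub>R ?g')
        \<le> (LINT p|lborel. norm (h p) * (W\<^sup>2 * \<bar>y - s\<bar>\<^sup>2 / 2))"
      unfolding split
    proof (rule Bochner_Integration.integral_norm_bound_integral)
      show "integrable lborel (\<lambda>p. h p * iexp (y * w p) - h p * iexp (s * w p)
         - (y - s) *\<^sub>R (h p * (\<i> * w p * iexp (s * w p))))"
        using i1 i2 by (intro Bochner_Integration.integrable_diff integrable_scaleR_right) auto
      show "integrable lborel (\<lambda>p. norm (h p) * (W\<^sup>2 * \<bar>y - s\<bar>\<^sup>2 / 2))"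
        using h by (intro integrable_mult_left integrable_norm) auto
      fix p
      have eq: "h p * iexp (y * w p) - h p * iexp (s * w p)
           - (y - s) *\<^sub>R (h p * (\<i> * w p * iexp (s * w p)))
         = h p * iexp (s * w p) * (iexp ((y - s) * w p) - (1 + \<i> * ((y - s) * w p)))"
        by (simp add: algebra_simps scaleR_conv_of_real flip: exp_add)
      have "cmod (iexp ((y - s) * w p) - (1 + \<i> * ((y - s) * w p))) \<le> \<bar>(y - s) * w p\<bar>\<^sup>2 / 2"
        using iexp_approx1[of "(y - s) * w p" 1] by (simp add: power2_eq_square)
      moreover have "\<bar>(y - s) * w p\<bar>\<^sup>2 \<le> W\<^sup>2 * \<bar>y - s\<bar>\<^sup>2" if "h p \<noteq> 0"
        using power_mono[OF W[OF that], of 2]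
        by (simp add: abs_mult power_mult_distrib mult.commute mult_right_mono)
      ultimately show "norm (h p * iexp (y * w p) - h p * iexp (s * w p)
           - (y - s) *\<^sub>R (h p * (\<i> * w p * iexp (s * w p))))
         \<le> norm (h p) * (W\<^sup>2 * \<bar>y - s\<bar>\<^sup>2 / 2)"
        unfolding eq by (cases "h p = 0") (force simp: norm_mult intro!: mult_left_mono)+
    qed
    moreover have "(LINT p|lborel. norm (h p) * (W\<^sup>2 * \<bar>y - s\<bar>\<^sup>2 / 2)) = K * \<bar>y - s\<bar>\<^sup>2"
      unfolding K_def integral_mult_left_zero by simp
    ultimately show ?thesis by (simp only:)
  qed
  have K: "K \<ge> 0" by (simp add: K_def)
  have "((\<lambda>y. norm (?g y - ?g s - (y - s) *\<^sub>R ?g') / norm (y - s)) \<longlongrightarrow> 0) (at s)"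
  proof (rule tendsto_sandwich)
    show "\<forall>\<^sub>F y in at s. 0 \<le> norm (?g y - ?g s - (y - s) *\<^sub>R ?g') / norm (y - s)"
      by (intro always_eventually) simp
    have "norm (?g y - ?g s - (y - s) *\<^sub>R ?g') / norm (y - s) \<le> K * \<bar>y - s\<bar>" if "y \<noteq> s" for y
      using bound[of y] that by (simp only: real_norm_def divide_le_eq power2_eq_square mult.assoc) simp
    then show "\<forall>\<^sub>F y in at s. norm (?g y - ?g s - (y - s) *\<^sub>R ?g') / norm (y - s) \<le> K * \<bar>y - s\<bar>"
      by (auto simp: eventually_at_filter)
    show "((\<lambda>y. K * \<bar>y - s\<bar>) \<longlongrightarrow> 0) (at s)" by (auto intro!: tendsto_eq_intros)
  qed auto
  then show ?thesis
    unfolding has_vector_derivative_def has_derivative_iff_norm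
    by (auto simp: bounded_linear_scaleR_left)
qed

lemma condition_C_integrable:
  assumes "p1 < p2" "0 < \<mu>" and C: "condition_C p1 p2 \<mu> g"
  shows "integrable lborel g"
proof -
  obtain v where v: "C1_on_interval p1 p2 v"
    and gv: "\<And>p. p \<in> {p1<..p2} \<Longrightarrow> g p = of_real ((p - p1) powr (\<mu> - 1)) * v p"
    and g0: "\<And>p. p \<notin> {p1..p2} \<Longrightarrow> g p = 0"
    using C by (auto simp: condition_C_def)
  have cont: "continuous_on {p1..p2} v"
    using v unfolding C1_on_interval_def
    by (auto simp: continuous_on_eq_continuous_within intro: has_vector_derivative_continuous)
  define V where "V p = (indicator {p1..p2} p *\<^sub>R v p :: complex)" for p
  define h where "h p = indicator {0..p2 - p1} p *\<^sub>R p powr (\<mu> - 1)" for p :: real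
  have Vm: "V \<in> borel_measurable borel"
    unfolding V_def using borel_measurable_continuous_on_indicator[OF _ cont] by simp
  obtain B where B: "\<And>p. p \<in> {p1..p2} \<Longrightarrow> norm (v p) \<le> B"
    using compact_imp_bounded[OF compact_continuous_image[OF cont]]
    by (auto simp: bounded_iff simp del: atLeastAtMost_iff)
  have "(\<lambda>p. p powr (\<mu> - 1)) absolutely_integrable_on {0..p2 - p1}"
    using assms by (intro nonnegative_absolutely_integrable_1 integrable_on_powr_from_0) auto
  then have "integrable lborel h"
    unfolding h_def set_integrable_def by (subst (asm) integrable_completion) auto
  then have "integrable lborel (\<lambda>p. h (- p1 + 1 * p))"
    by (subst lborel_integrable_real_affine_iff) auto
  then have "integrable lborel (\<lambda>p. complex_of_real (h (p - p1)))" by simp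
  then have *: "integrable lborel (\<lambda>p. complex_of_real (h (p - p1)) * V p)"
    by (rule integrable_mult_bounded[OF _ Vm, where B = B])
       (auto simp: h_def V_def indicator_def B split: if_splits)
  define k where "k p = complex_of_real (h (p - p1)) * V p + indicator {p1} p *\<^sub>R g p1" for p
  have "g = k"
  proof
    fix p
    consider "p = p1" | "p \<in> {p1<..p2}" | "p \<notin> {p1..p2}" by force
    then show "g p = k p"
      by cases (use assms(1) in \<open>auto simp: k_def h_def V_def gv g0 indicator_def\<close>)
  qed
  moreover have "integrable lborel k"
    unfolding k_def by (intro Bochner_Integration.integrable_add[OF *] integrable_scaleR_left) auto
  ultimately show ?thesis by simp
qed

lemma schrodinger_integral_solves:
  assumes "p1 < p2" "0 < \<mu>" and C: "condition_C p1 p2 \<mu> g"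
  shows "solves_free_schrodinger (schrodinger_integral p1 p2 g 0) (schrodinger_integral p1 p2 g)"
proof -
  let ?u = "schrodinger_integral p1 p2 g"
  have gi: "integrable lborel g" by (rule condition_C_integrable[OF assms])
  have g0: "p \<in> {p1..p2}" if "g p \<noteq> 0" for p using C that by (auto simp: condition_C_def)
  define R where "R = max \<bar>p1\<bar> \<bar>p2\<bar>"
  have R: "\<bar>p\<bar> \<le> R" "\<bar>p\<^sup>2\<bar> \<le> R\<^sup>2" if "g p \<noteq> 0" for p
  proof -
    show *: "\<bar>p\<bar> \<le> R" using g0[OF that] by (auto simp: R_def)
    show "\<bar>p\<^sup>2\<bar> \<le> R\<^sup>2" using power_mono[OF *, of 2] by simp
  qed
  define e where "e t x p = iexp (- (t * p\<^sup>2) + x * p)" for t x p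
  have e_m[measurable]: "e t x \<in> borel_measurable borel" for t x unfolding e_def by measurable
  have e1: "norm (e t x p) = 1" for t x p by (simp add: e_def)
  have u_eq: "?u t x = 1 / (2 * of_real pi) * (LINT p|lborel. g p * e t x p)" for t x
  proof -
    have "(LINT p:{p1..p2}|lborel. g p * exp (- \<i> * of_real (t * p\<^sup>2) + \<i> * of_real (x * p)))
        = (LINT p|lborel. g p * e t x p)"
      unfolding set_lebesgue_integral_def
      by (rule Bochner_Integration.integral_cong)
         (use g0 in \<open>force simp: e_def indicator_def algebra_simps\<close>)+
    then show ?thesis by (simp add: schrodinger_integral_def)
  qed
  define I where "I k t x = 1 / (2 * of_real pi) * (LINT p|lborel. g p * k p * e t x p)"
    for k :: "real \<Rightarrow> complex" and t x
  have dt: "((\<lambda>s. ?u s x) has_vector_derivative I (\<lambda>p. - \<i> * of_real (p\<^sup>2)) t x) (at t)" for t x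
  proof -
    have i: "integrable lborel (\<lambda>p. g p * e 0 x p)"
      by (rule integrable_mult_bounded[OF gi, where B = 1]) (auto simp: e1)
    have "((\<lambda>s. LINT p|lborel. g p * e 0 x p * iexp (s * (- p\<^sup>2))) has_vector_derivative
       (LINT p|lborel. g p * e 0 x p * (\<i> * of_real (- p\<^sup>2) * iexp (t * (- p\<^sup>2))))) (at t)"
      by (rule oscillatory_has_vector_derivative[OF i, where W = "R\<^sup>2"]) (use R in auto)
    moreover have "e 0 x p * iexp (s * (- p\<^sup>2)) = e s x p" for s p
      by (simp add: e_def algebra_simps flip: exp_add)
    then have "g p * e 0 x p * iexp (s * (- p\<^sup>2)) = g p * e s x p"
      "g p * e 0 x p * (\<i> * of_real (- p\<^sup>2) * iexp (s * (- p\<^sup>2))) = g p * (- \<i> * of_real (p\<^sup>2)) * e s x p"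
      for s p by (simp_all add: algebra_simps)
    ultimately have "((\<lambda>s. LINT p|lborel. g p * e s x p) has_vector_derivative
       (LINT p|lborel. g p * (- \<i> * of_real (p\<^sup>2)) * e t x p)) (at t)" by (simp only:)
    then show ?thesis
      unfolding u_eq I_def by (rule has_vector_derivative_mult_right)
  qed
  have dx: "(I k t has_vector_derivative I (\<lambda>p. k p * (\<i> * p)) t x) (at x)"
    if k[measurable]: "k \<in> borel_measurable borel" and B: "\<And>p. g p \<noteq> 0 \<Longrightarrow> norm (k p) \<le> B"
    for k B t x
  proof -
    have i: "integrable lborel (\<lambda>p. g p * (k p * e t 0 p))"
      by (rule integrable_mult_bounded[OF gi, where B = B]) (auto simp: e1 norm_mult B)
    have "((\<lambda>y. LINT p|lborel. g p * (k p * e t 0 p) * iexp (y * p)) has_vector_derivative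
       (LINT p|lborel. g p * (k p * e t 0 p) * (\<i> * of_real p * iexp (x * p)))) (at x)"
      by (rule oscillatory_has_vector_derivative[OF i, where W = R]) (use R in auto)
    moreover have "e t 0 p * iexp (y * p) = e t y p" for y p
      by (simp add: e_def algebra_simps flip: exp_add)
    then have "g p * (k p * e t 0 p) * iexp (y * p) = g p * k p * e t y p"
      "g p * (k p * e t 0 p) * (\<i> * of_real p * iexp (y * p)) = g p * (k p * (\<i> * p)) * e t y p"
      for y p by (simp_all add: algebra_simps)
    ultimately have "((\<lambda>y. LINT p|lborel. g p * k p * e t y p) has_vector_derivative
       (LINT p|lborel. g p * (k p * (\<i> * p)) * e t x p)) (at x)" by (simp only:)
    then show ?thesis
      unfolding I_def by (rule has_vector_derivative_mult_right)
  qed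
  have u_I: "?u t = I (\<lambda>_. 1) t" for t by (auto simp: u_eq I_def)
  have d1: "(?u t has_vector_derivative I (\<lambda>p. \<i> * p) t x) (at x)" for t x
    using dx[of "\<lambda>_. 1" 1] by (simp add: u_I)
  have d2: "(I (\<lambda>p. \<i> * p) t has_vector_derivative I (\<lambda>p. \<i> * p * (\<i> * p)) t x) (at x)" for t x
    by (rule dx[where B = R]) (use R in \<open>auto simp: norm_mult\<close>)
  have pde: "\<i> * I (\<lambda>p. - \<i> * of_real (p\<^sup>2)) t x + I (\<lambda>p. \<i> * p * (\<i> * p)) t x = 0" for t x
  proof -
    have 1: "g p * (- \<i> * of_real (p\<^sup>2)) * e t x p = (- \<i>) * (g p * p\<^sup>2 * e t x p)"
      "g p * (\<i> * p * (\<i> * p)) * e t x p = (- 1) * (g p * p\<^sup>2 * e t x p)" for p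
      by (simp_all add: power2_eq_square algebra_simps)
    show ?thesis unfolding I_def 1 integral_mult_right_zero by (simp add: algebra_simps)
  qed
  have cont: "continuous_on ({0..} \<times> UNIV) (\<lambda>(t, x). ?u t x)"
  proof (rule continuous_on_sequentiallyI)
    fix q and a assume "q \<longlonglongrightarrow> (a :: real \<times> real)"
    then have lim: "(\<lambda>n. fst (q n)) \<longlonglongrightarrow> fst a" "(\<lambda>n. snd (q n)) \<longlonglongrightarrow> snd a"
      by (auto intro: tendsto_fst tendsto_snd)
    have "(\<lambda>n. LINT p|lborel. g p * e (fst (q n)) (snd (q n)) p)
        \<longlonglongrightarrow> (LINT p|lborel. g p * e (fst a) (snd a) p)"
    proof (rule integral_dominated_convergence)
      show "integrable lborel (\<lambda>p. norm (g p))" using gi by simp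
      show "AE p in lborel. (\<lambda>n. g p * e (fst (q n)) (snd (q n)) p)
          \<longlonglongrightarrow> g p * e (fst a) (snd a) p"
        unfolding e_def by (intro AE_I2 tendsto_intros lim)
    qed (use borel_measurable_integrable[OF gi] in \<open>auto simp: norm_mult e1\<close>)
    then show "(\<lambda>n. case q n of (t, x) \<Rightarrow> ?u t x) \<longlonglongrightarrow> (case a of (t, x) \<Rightarrow> ?u t x)"
      unfolding u_eq case_prod_beta by (intro tendsto_intros)
  qed
  show ?thesis
    unfolding solves_free_schrodinger_def
  proof (intro conjI exI allI impI)
    fix t x :: real
    show "((\<lambda>s. ?u s x) has_vector_derivative I (\<lambda>p. - \<i> * of_real (p\<^sup>2)) t x) (at t)" by (rule dt)
    show "(?u t has_vector_derivative I (\<lambda>p. \<i> * p) t x) (at x)" by (rule d1)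
    show "(I (\<lambda>p. \<i> * p) t has_vector_derivative I (\<lambda>p. \<i> * p * (\<i> * p)) t x) (at x)"
      by (rule d2)
    show "\<i> * I (\<lambda>p. - \<i> * of_real (p\<^sup>2)) t x + I (\<lambda>p. \<i> * p * (\<i> * p)) t x = 0" by (rule pde)
  qed (use cont in simp_all)
qed

end

(* Up to a unimodular factor the integrand is (p - p1) powr (mu - 1) * v p * exp (- i t (p - p0)^2)
   with stationary point p0 = x / (2 t).  Put d = p0 - p1.  Integration by parts combined with the
   bounds O(1 / (t d)) and O(1 / sqrt t) for the pure phase integrals away from and across p0, after
   cutting off a piece of length proportional to 1 / (t d) at p1, gives
   |u(t,x)| <= C ((t d) powr (- mu) + t powr (- 1 / 2) * d powr (mu - 1)).  On the region
   d >= t powr (- eps), and comparing the two resulting powers of t yields the three cases. *)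

theory Submission
  imports Defs
begin

section \<open>Integration by parts against an oscillating factor\<close>

text \<open>Oscillation of \<open>w\<close> enters only through its primitive \<open>G\<close>
  starting at \<open>a\<close>, which is bounded by \<open>M\<close>; integration by parts puts the
  derivative on \<open>f\<close>, whose variation is at most \<open>J\<close>. The boundary term at
  \<open>a\<close> vanishes because \<open>G a = 0\<close>.\<close>

lemma norm_integral_mult_le_by_parts:
  fixes f f' w :: "real \<Rightarrow> complex"
  assumes "a \<le> b"
    and f: "\<And>p. p \<in> {a..b} \<Longrightarrow> (f has_vector_derivative f' p) (at p within {a..b})"
    and f': "continuous_on {a..b} f'" and w: "continuous_on {a..b} w"
    and k: "\<And>p. p \<in> {a..b} \<Longrightarrow> norm (f' p) \<le> k p" "(k has_integral J) {a..b}"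
    and M: "\<And>q. q \<in> {a..b} \<Longrightarrow> norm (integral {a..q} w) \<le> M"
  shows "norm (integral {a..b} (\<lambda>p. f p * w p)) \<le> M * (norm (f b) + J)"
proof -
  define G where "G q = integral {a..q} w" for q
  have G: "(G has_vector_derivative w q) (at q within {a..b})" if "q \<in> {a..b}" for q
    unfolding G_def by (rule integral_has_vector_derivative[OF w that])
  have contG: "continuous_on {a..b} G"
    by (rule continuous_on_vector_derivative[OF G])
  have intf': "(\<lambda>p. f' p * G p) integrable_on {a..b}"
    by (intro integrable_continuous_interval continuous_on_mult f' contG)
  have "((\<lambda>p. f p * w p + f' p * G p) has_integral f b * G b - f a * G a) {a..b}"
    by (rule fundamental_theorem_of_calculus[OF \<open>a \<le> b\<close>])
       (intro has_vector_derivative_mult f G, assumption+)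
  then have "((\<lambda>p. f p * w p + f' p * G p - f' p * G p) has_integral
      f b * G b - f a * G a - integral {a..b} (\<lambda>p. f' p * G p)) {a..b}"
    by (rule has_integral_diff) (use intf' in \<open>simp add: integrable_integral\<close>)
  then have eq: "integral {a..b} (\<lambda>p. f p * w p) = f b * G b - integral {a..b} (\<lambda>p. f' p * G p)"
    by (simp add: G_def integral_unique)
  have "norm (integral {a..b} (\<lambda>p. f' p * G p)) \<le> integral {a..b} (\<lambda>p. k p * M)"
  proof (rule integral_norm_bound_integral[OF intf'])
    show "(\<lambda>p. k p * M) integrable_on {a..b}" using k(2) by (intro integrable_on_mult_left) auto
    show "norm (f' p * G p) \<le> k p * M" if "p \<in> {a..b}" for p
      using k(1)[OF that] M[OF that] unfolding norm_mult G_def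
      by (meson mult_mono norm_ge_zero order_trans)
  qed
  also have "\<dots> = J * M"
    using has_integral_mult_left[OF k(2)] by (rule integral_unique)
  finally have "norm (integral {a..b} (\<lambda>p. f' p * G p)) \<le> J * M" .
  moreover have "norm (f b * G b) \<le> norm (f b) * M"
    using M[of b] \<open>a \<le> b\<close> by (simp add: norm_mult G_def mult_left_mono)
  ultimately show ?thesis
    unfolding eq using norm_triangle_ineq4[of "f b * G b" "integral {a..b} (\<lambda>p. f' p * G p)"]
    by (simp add: algebra_simps)
qed

section \<open>Integrals of the pure quadratic phase\<close>

text \<open>This is what remains of the Schroedinger phase after completing the square: with
  \<open>p0 = x / (2 * t)\<close>, the exponent \<open>- t p^2 + x p\<close> equals
  \<open>t p0^2 - t (p - p0)^2\<close>, and the first summand does not depend on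
  \<open>p\<close>.\<close>

definition chirp :: "real \<Rightarrow> real \<Rightarrow> real \<Rightarrow> complex" where
  "chirp t p0 p = cis (- (t * (p - p0)\<^sup>2))"

lemma norm_chirp [simp]: "norm (chirp t p0 p) = 1"
  by (simp add: chirp_def)

lemma chirp_has_vector_derivative:
  "(chirp t p0 has_vector_derivative - (2 * \<i> * of_real (t * (p - p0))) * chirp t p0 p) (at p within S)"
  unfolding chirp_def has_vector_derivative_def
  by (rule derivative_eq_intros refl)+ (auto simp: scaleR_conv_of_real algebra_simps)

lemma continuous_on_chirp [continuous_intros]: "continuous_on S (chirp t p0)"
  by (rule continuous_on_vector_derivative, rule chirp_has_vector_derivative)

lemma chirp_integrable: "chirp t p0 integrable_on {a..b}"
  by (intro integrable_continuous_interval continuous_intros)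

text \<open>Van der Corput's argument away from the stationary point: the chirp is its own
  derivative divided by \<open>- 2 \<i> t (p - p0)\<close>. Integrating by parts leaves quantities
  controlled by \<open>1 / (t \<bar>p - p0\<bar>)\<close> at the endpoints, where
  \<open>\<bar>p - p0\<bar>\<close> is at least \<open>\<eta>\<close>.\<close>

lemma chirp_integral_nonstationary:
  assumes "0 < t" "0 < \<eta>" "a \<le> b" "b \<le> p0 - \<eta> \<or> p0 + \<eta> \<le> a"
  shows "norm (integral {a..b} (chirp t p0)) \<le> 2 / (t * \<eta>)"
proof -
  have ne: "p - p0 \<noteq> 0" if "p \<in> {a..b}" for p using assms that by auto
  \<comment> \<open>\<open>F\<close> is the chirp divided by the derivative of its exponent, since
    \<open>1 / (- 2 \<i>) = \<i> / 2\<close>; \<open>R\<close> is the error made by differentiating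
    \<open>1 / (p - p0)\<close> as well.\<close>
  define F where "F p = \<i> / (2 * of_real t) * (of_real (inverse (p - p0)) * chirp t p0 p)" for p
  define R where "R p = \<i> / (2 * of_real t) * (of_real (inverse ((p - p0)\<^sup>2)) * chirp t p0 p)" for p
  have "(F has_vector_derivative chirp t p0 p - R p) (at p within {a..b})" if "p \<in> {a..b}" for p
  proof -
    have "((\<lambda>p. inverse (p - p0)) has_field_derivative - inverse ((p - p0)\<^sup>2)) (at p within {a..b})"
      using ne[OF that] by (auto intro!: derivative_eq_intros simp: power2_eq_square)
    then have inv: "((\<lambda>p. complex_of_real (inverse (p - p0))) has_vector_derivative
        of_real (- inverse ((p - p0)\<^sup>2))) (at p within {a..b})"
      by (intro has_vector_derivative_of_real) (simp add: has_real_derivative_iff_has_vector_derivative)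
    have "\<i> / (2 * T) * (inverse z * (- (2 * \<i> * (T * z)) * c) + - inverse (z\<^sup>2) * c)
        = c - \<i> / (2 * T) * (inverse (z\<^sup>2) * c)" if "T \<noteq> 0" "z \<noteq> 0" for T z c
      using that by (simp add: field_simps power2_eq_square)
    from this[of "of_real t" "of_real (p - p0)" "chirp t p0 p"]
    have eq: "\<i> / (2 * of_real t) * (of_real (inverse (p - p0)) * (- (2 * \<i> * of_real (t * (p - p0))) * chirp t p0 p)
        + of_real (- inverse ((p - p0)\<^sup>2)) * chirp t p0 p) = chirp t p0 p - R p"
      using ne[OF that] \<open>0 < t\<close> by (simp add: R_def del: of_real_diff)
    show ?thesis
      unfolding F_def eq[symmetric]
      by (intro has_vector_derivative_mult_right has_vector_derivative_mult inv chirp_has_vector_derivative)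
  qed
  then have "((\<lambda>p. chirp t p0 p - R p) has_integral F b - F a) {a..b}"
    by (intro fundamental_theorem_of_calculus \<open>a \<le> b\<close>)
  moreover have R: "R integrable_on {a..b}"
    unfolding R_def using ne by (intro integrable_continuous_interval continuous_intros) auto
  ultimately have eq: "integral {a..b} (chirp t p0) = F b - F a + integral {a..b} R"
    using integral_diff[OF chirp_integrable R, of t p0] by (simp add: integral_unique algebra_simps)
  \<comment> \<open>The modulus of \<open>R\<close> has an explicit primitive, so integrating it
    yields endpoint values of the same size as the boundary terms of \<open>F\<close>.\<close>
  have "((\<lambda>p. inverse ((p - p0)\<^sup>2)) has_integral - inverse (b - p0) - (- inverse (a - p0))) {a..b}"
    using ne
    by (intro fundamental_theorem_of_calculus \<open>a \<le> b\<close>)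
       (auto intro!: derivative_eq_intros simp flip: has_real_derivative_iff_has_vector_derivative
          simp: power2_eq_square)
  from has_integral_divide[OF this, of "2 * t"]
  have k: "((\<lambda>p. inverse ((p - p0)\<^sup>2) / (2 * t)) has_integral
      (- inverse (b - p0) - (- inverse (a - p0))) / (2 * t)) {a..b}" .
  have normR: "norm (R p) = inverse ((p - p0)\<^sup>2) / (2 * t)" for p
    using \<open>0 < t\<close>
    by (simp add: R_def norm_mult norm_divide del: of_real_diff of_real_inverse of_real_power)
  have "norm (integral {a..b} R) \<le> integral {a..b} (\<lambda>p. inverse ((p - p0)\<^sup>2) / (2 * t))"
    using k by (intro integral_norm_bound_integral R) (auto simp only: normR)
  then have "norm (integral {a..b} R) \<le> (\<bar>inverse (a - p0)\<bar> + \<bar>inverse (b - p0)\<bar>) / (2 * t)"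
    unfolding integral_unique[OF k]
    by (rule order_trans) (use \<open>0 < t\<close> in \<open>intro divide_right_mono; linarith\<close>)
  then have "norm (integral {a..b} R) \<le> \<bar>inverse (a - p0)\<bar> / (2 * t) + \<bar>inverse (b - p0)\<bar> / (2 * t)"
    by (simp only: add_divide_distrib)
  moreover have "norm (F p) = \<bar>inverse (p - p0)\<bar> / (2 * t)" for p
    using \<open>0 < t\<close> by (simp add: F_def norm_mult norm_divide del: of_real_diff of_real_inverse)
  \<comment> \<open>The boundary terms and the remainder each contribute one copy of the same
    endpoint sum over \<open>2 * t\<close>.\<close>
  moreover have "(x + y) / t = 2 * (x / (2 * t)) + 2 * (y / (2 * t))" for x y
    by (simp add: add_divide_distrib)
  ultimately have "norm (integral {a..b} (chirp t p0)) \<le> (\<bar>inverse (a - p0)\<bar> + \<bar>inverse (b - p0)\<bar>) / t"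
    unfolding eq using norm_triangle_ineq[of "F b - F a" "integral {a..b} R"]
      norm_triangle_ineq4[of "F b" "F a"]
    by smt
  also have "\<dots> \<le> (inverse \<eta> + inverse \<eta>) / t"
  proof -
    have "\<bar>inverse (p - p0)\<bar> \<le> inverse \<eta>" if "p \<in> {a..b}" for p
      using assms that unfolding abs_inverse by (intro le_imp_inverse_le) auto
    then show ?thesis using assms by (intro divide_right_mono add_mono) auto
  qed
  finally show ?thesis by (simp add: field_simps)
qed

text \<open>Within distance \<open>\<eta>\<close> of \<open>p0\<close> the integral is at most the
  length \<open>2 * \<eta>\<close>, and on either side the nonstationary bound gives
  \<open>2 / (t * \<eta>)\<close>. Both agree for \<open>\<eta> = 1 / sqrt t\<close>, so three
  pieces give the constant 6.\<close>

lemma chirp_integral_le: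
  assumes "0 < t" "a \<le> b"
  shows "norm (integral {a..b} (chirp t p0)) \<le> 6 / sqrt t"
proof -
  define \<eta> where "\<eta> = 1 / sqrt t"
  have \<eta>: "0 < \<eta>" "t * \<eta> = sqrt t" using assms by (auto simp: \<eta>_def real_div_sqrt)
  \<comment> \<open>The cut points \<open>p0 - \<eta>\<close> and \<open>p0 + \<eta>\<close> are
    clamped to \<open>{a..b}\<close>, so that every position of \<open>p0\<close> is covered; pieces
    that are not present degenerate to a point.\<close>
  define c1 where "c1 = max a (min b (p0 - \<eta>))"
  define c2 where "c2 = max c1 (min b (p0 + \<eta>))"
  have c: "a \<le> c1" "c1 \<le> c2" "c2 \<le> b" using assms by (auto simp: c1_def c2_def)
  have 1: "norm (integral {a..c1} (chirp t p0)) \<le> 2 / sqrt t"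
  proof (cases "a = c1")
    case False
    then have "c1 \<le> p0 - \<eta>" by (auto simp: c1_def)
    then show ?thesis using chirp_integral_nonstationary[of t \<eta> a c1 p0] assms \<eta> c by simp
  qed (use assms in simp)
  have 3: "norm (integral {c2..b} (chirp t p0)) \<le> 2 / sqrt t"
  proof (cases "c2 = b")
    case False
    then have "p0 + \<eta> \<le> c2" using c by (auto simp: c2_def)
    then show ?thesis using chirp_integral_nonstationary[of t \<eta> c2 b p0] assms \<eta> c by simp
  qed (use assms in simp)
  have "norm (integral {c1..c2} (chirp t p0)) \<le> integral {c1..c2} (\<lambda>_. 1 :: real)"
    by (rule integral_norm_bound_integral) (auto simp: chirp_integrable)
  also have "\<dots> \<le> 2 / sqrt t" 
  proof -
    have "c2 - c1 \<le> 2 * \<eta>" using \<eta>(1) by (auto simp: c1_def c2_def max_def min_def)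
    then show ?thesis using c by (simp add: \<eta>_def)
  qed
  finally have 2: "norm (integral {c1..c2} (chirp t p0)) \<le> 2 / sqrt t" .
  have "integral {a..b} (chirp t p0) =
      integral {a..c1} (chirp t p0) + integral {c1..c2} (chirp t p0) + integral {c2..b} (chirp t p0)"
    using c by (simp add: Henstock_Kurzweil_Integration.integral_combine chirp_integrable)
  also have "norm \<dots> \<le> 2 / sqrt t + 2 / sqrt t + 2 / sqrt t"
    by (intro norm_triangle_mono 1 2 3)
  finally show ?thesis by simp
qed


section \<open>Amplitudes with a power singularity\<close>

lemma powr_has_integral_shifted:
  fixes c a b r :: real
  assumes "c < a" "a \<le> b" "r \<noteq> 0"
  shows "((\<lambda>p. (p - c) powr (r - 1)) has_integral ((b - c) powr r - (a - c) powr r) / r) {a..b}"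
proof -
  have "((\<lambda>p. (p - c) powr (r - 1)) has_integral (b - c) powr r / r - (a - c) powr r / r) {a..b}"
    using assms
    by (intro fundamental_theorem_of_calculus)
       (auto intro!: derivative_eq_intros simp flip: has_real_derivative_iff_has_vector_derivative)
  then show ?thesis by (simp add: diff_divide_distrib)
qed

text \<open>For \<open>r < 1\<close> the integrand is unbounded near \<open>c\<close>; the
  fundamental theorem is used in the form that asks for continuity of the primitive up to
  \<open>c\<close> and for its derivative only in the interior.\<close>

lemma powr_has_integral_shifted_from_0:
  fixes c a r :: real
  assumes "c \<le> a" "0 < r"
  shows "((\<lambda>p. (p - c) powr (r - 1)) has_integral (a - c) powr r / r) {c..a}"
proof -
  have "((\<lambda>p. (p - c) powr (r - 1)) has_integral (a - c) powr r / r - (c - c) powr r / r) {c..a}"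
    using assms
    by (intro fundamental_theorem_of_calculus_interior continuous_on_powr' continuous_intros)
       (auto intro!: derivative_eq_intros simp flip: has_real_derivative_iff_has_vector_derivative)
  then show ?thesis by simp
qed

text \<open>As \<open>\<mu> < 1\<close>, the weight decreases, so on \<open>{a..b}\<close> the size
  and variation of the amplitude are controlled by the weight at \<open>a\<close>. The factor
  \<open>w\<close> and its bound \<open>M\<close> stay abstract to serve both away from the
  stationary point and across it.\<close>

lemma singular_amplitude_integral_le:
  fixes v v' w :: "real \<Rightarrow> complex" and \<mu> :: real
  assumes "\<mu> < 1" "p1 < a" "a \<le> b" "b \<le> p2"
    and v: "\<And>p. p \<in> {p1..p2} \<Longrightarrow> (v has_vector_derivative v' p) (at p within {p1..p2})"
    and v': "continuous_on {p1..p2} v'"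
    and B: "\<And>p. p \<in> {p1..p2} \<Longrightarrow> norm (v p) \<le> B"
    and B': "\<And>p. p \<in> {p1..p2} \<Longrightarrow> norm (v' p) \<le> B'"
    and w: "continuous_on {a..b} w"
    and M: "\<And>q. q \<in> {a..b} \<Longrightarrow> norm (integral {a..q} w) \<le> M"
  shows "norm (integral {a..b} (\<lambda>p. of_real ((p - p1) powr (\<mu> - 1)) * v p * w p))
    \<le> M * ((B + B' * (p2 - p1) / (1 - \<mu>)) * (a - p1) powr (\<mu> - 1))"
proof -
  define f where "f p = of_real ((p - p1) powr (\<mu> - 1)) * v p" for p
  define f' where "f' p = of_real ((p - p1) powr (\<mu> - 1)) * v' p
      + of_real ((\<mu> - 1) * (p - p1) powr (\<mu> - 2)) * v p" for p
  \<comment> \<open>Since \<open>p - p1 \<le> p2 - p1\<close>, the term with \<open>v'\<close> can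
    also be brought to the exponent \<open>\<mu> - 2\<close>. \<open>A\<close> is chosen so that
    \<open>A * (1 - \<mu>)\<close> collects both coefficients, and \<open>k\<close> then integrates
    to \<open>A\<close> times the drop of the weight.\<close>
  define A where "A = B + B' * (p2 - p1) / (1 - \<mu>)"
  define k where "k p = A * (1 - \<mu>) * (p - p1) powr (\<mu> - 2)" for p
  have sub: "{a..b} \<subseteq> {p1..p2}" using assms by auto
  have vab: "(v has_vector_derivative v' p) (at p within {a..b})" if "p \<in> {a..b}" for p
    using v sub that by (blast intro: has_vector_derivative_within_subset)
  have M0: "0 \<le> M" using M[of a] \<open>a \<le> b\<close> by simp
  have nonneg: "0 \<le> B" "0 \<le> B'"
    using B[of p1] B'[of p1] assms(2-4) norm_ge_zero[of "v p1"] norm_ge_zero[of "v' p1"]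
    by (simp_all del: norm_ge_zero)
  have "norm (integral {a..b} (\<lambda>p. f p * w p)) \<le> M * (norm (f b) + A * ((a - p1) powr (\<mu> - 1) - (b - p1) powr (\<mu> - 1)))"
  proof (rule norm_integral_mult_le_by_parts[OF \<open>a \<le> b\<close> _ _ w _ _ M])
    show "(f has_vector_derivative f' p) (at p within {a..b})" if "p \<in> {a..b}" for p
    proof -
      have "((\<lambda>p. (p - p1) powr (\<mu> - 1)) has_field_derivative (\<mu> - 1) * (p - p1) powr (\<mu> - 2))
          (at p within {a..b})"
        using that assms by (auto intro!: derivative_eq_intros)
      then have "((\<lambda>p. complex_of_real ((p - p1) powr (\<mu> - 1))) has_vector_derivative
          of_real ((\<mu> - 1) * (p - p1) powr (\<mu> - 2))) (at p within {a..b})"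
        by (intro has_vector_derivative_of_real) (simp add: has_real_derivative_iff_has_vector_derivative)
      from has_vector_derivative_mult[OF this vab[OF that]] show ?thesis
        unfolding f_def f'_def .
    qed
    have "continuous_on {a..b} v"
      by (rule continuous_on_vector_derivative[OF vab])
    then show "continuous_on {a..b} f'"
      unfolding f'_def using assms continuous_on_subset[OF v' sub]
      by (intro continuous_intros) auto
    show "norm (f' p) \<le> k p" if "p \<in> {a..b}" for p
    proof -
      have p: "p \<in> {p1..p2}" "p1 < p" using that sub assms by auto
      have "norm (f' p) \<le> (p - p1) powr (\<mu> - 1) * norm (v' p) + (1 - \<mu>) * (p - p1) powr (\<mu> - 2) * norm (v p)"
        unfolding f'_def by (rule order_trans[OF norm_triangle_ineq]) (use \<open>\<mu> < 1\<close> in \<open>simp add: norm_mult abs_mult del: of_real_mult of_real_diff\<close>)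
      also have "(p - p1) powr (\<mu> - 1) = (p - p1) * (p - p1) powr (\<mu> - 2)"
        using p powr_add[of "p - p1" 1 "\<mu> - 2"] by simp
      also have "(p - p1) * (p - p1) powr (\<mu> - 2) * norm (v' p) + (1 - \<mu>) * (p - p1) powr (\<mu> - 2) * norm (v p)
          \<le> (p2 - p1) * (p - p1) powr (\<mu> - 2) * B' + (1 - \<mu>) * (p - p1) powr (\<mu> - 2) * B"
        using p B[OF p(1)] B'[OF p(1)] \<open>\<mu> < 1\<close> by (intro add_mono mult_mono) auto
      also have "\<dots> = k p"
        using \<open>\<mu> < 1\<close> by (simp add: k_def A_def field_simps)
      finally show ?thesis .
    qed
    have "(k has_integral A * (1 - \<mu>) * (((b - p1) powr (\<mu> - 1) - (a - p1) powr (\<mu> - 1)) / (\<mu> - 1))) {a..b}"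
      using powr_has_integral_shifted[of p1 a b "\<mu> - 1"] assms
      unfolding k_def by (intro has_integral_mult_right) auto
    then show "(k has_integral A * ((a - p1) powr (\<mu> - 1) - (b - p1) powr (\<mu> - 1))) {a..b}"
      by (rule has_integral_eq_rhs) (use \<open>\<mu> < 1\<close> in \<open>simp add: field_simps\<close>)
  qed
  \<comment> \<open>The boundary value at \<open>b\<close> is absorbed by the negative term of the
    telescoped variation, leaving only the weight at \<open>a\<close>.\<close>
  also have "\<dots> \<le> M * (A * (a - p1) powr (\<mu> - 1))"
  proof -
    have "norm (f b) \<le> A * (b - p1) powr (\<mu> - 1)"
    proof -
      have "norm (v b) \<le> A"
        using B[of b] assms(1-4) nonneg by (auto simp: A_def intro: add_increasing2)
      then show ?thesis by (simp add: f_def norm_mult mult.commute[of A] mult_left_mono)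
    qed
    then show ?thesis using M0 by (intro mult_left_mono) (auto simp: algebra_simps)
  qed
  finally show ?thesis by (simp add: f_def A_def)
qed

text \<open>Near the singularity \<open>p1\<close> the integrand is bounded by its modulus; between \<open>p1 + h\<close> and the
  midpoint of \<open>p1\<close> and \<open>p0\<close> the phase is not stationary; beyond the midpoint the amplitude is
  regular and only the decay \<open>t powr (- 1 / 2)\<close> of the stationary point is available.\<close>

lemma singular_oscillatory_integral_le:
  fixes v v' :: "real \<Rightarrow> complex" and \<mu> :: real
  assumes "0 < \<mu>" "\<mu> < 1" "p1 < p0" "p0 \<le> p2" "0 < t" "0 < h" "h \<le> (p0 - p1) / 2"
    and v: "\<And>p. p \<in> {p1..p2} \<Longrightarrow> (v has_vector_derivative v' p) (at p within {p1..p2})"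
    and v': "continuous_on {p1..p2} v'"
    and B: "\<And>p. p \<in> {p1..p2} \<Longrightarrow> norm (v p) \<le> B"
    and B': "\<And>p. p \<in> {p1..p2} \<Longrightarrow> norm (v' p) \<le> B'"
    and int: "(\<lambda>p. of_real ((p - p1) powr (\<mu> - 1)) * v p * chirp t p0 p) integrable_on {p1..p2}"
  shows "norm (integral {p1..p2} (\<lambda>p. of_real ((p - p1) powr (\<mu> - 1)) * v p * chirp t p0 p))
    \<le> B * (h powr \<mu> / \<mu>)
      + 2 / (t * ((p0 - p1) / 2)) * ((B + B' * (p2 - p1) / (1 - \<mu>)) * h powr (\<mu> - 1))
      + 6 / sqrt t * ((B + B' * (p2 - p1) / (1 - \<mu>)) * ((p0 - p1) / 2) powr (\<mu> - 1))"
proof -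
  define F where "F = (\<lambda>p. of_real ((p - p1) powr (\<mu> - 1)) * v p * chirp t p0 p)"
  define a where "a = p1 + h"
  define m where "m = p1 + (p0 - p1) / 2"
  have ord: "p1 < a" "a \<le> m" "m < p0" "m \<le> p2"
    using assms by (auto simp: a_def m_def field_simps)
  \<comment> \<open>\<open>m\<close> is as far from \<open>p0\<close> as from \<open>p1\<close>;
    this common distance is the \<open>\<eta>\<close> of the nonstationary bound on
    \<open>{a..m}\<close> and the base of the weight on \<open>{m..p2}\<close>.\<close>
  have dist: "m \<le> p0 - (p0 - p1) / 2" by (simp add: m_def field_simps)
  have intF: "F integrable_on {c..d}" if "p1 \<le> c" "d \<le> p2" for c d
    by (rule integrable_on_subinterval[OF int[folded F_def]]) (use that in auto)
  have "norm (integral {p1..a} F) \<le> integral {p1..a} (\<lambda>p. B * (p - p1) powr (\<mu> - 1))"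
  proof (rule integral_norm_bound_integral)
    show "F integrable_on {p1..a}" using ord by (intro intF) auto
    show "(\<lambda>p. B * (p - p1) powr (\<mu> - 1)) integrable_on {p1..a}"
      using powr_has_integral_shifted_from_0[of p1 a \<mu>] assms ord by (intro integrable_on_mult_right) auto
    show "norm (F p) \<le> B * (p - p1) powr (\<mu> - 1)" if "p \<in> {p1..a}" for p
      using B[of p] that ord by (simp add: F_def norm_mult mult.commute[of B] mult_left_mono)
  qed
  also have "\<dots> = B * (h powr \<mu> / \<mu>)"
    using powr_has_integral_shifted_from_0[of p1 a \<mu>] assms ord
    by (simp add: integral_unique a_def)
  finally have 1: "norm (integral {p1..a} F) \<le> B * (h powr \<mu> / \<mu>)" .
  have 2: "norm (integral {a..m} F)
      \<le> 2 / (t * ((p0 - p1) / 2)) * ((B + B' * (p2 - p1) / (1 - \<mu>)) * (a - p1) powr (\<mu> - 1))"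
    unfolding F_def
    by (rule singular_amplitude_integral_le[OF \<open>\<mu> < 1\<close> ord(1,2,4) v v' B B' continuous_on_chirp
          chirp_integral_nonstationary])
       (use assms(1-7) dist in auto)
  have 3: "norm (integral {m..p2} F)
      \<le> 6 / sqrt t * ((B + B' * (p2 - p1) / (1 - \<mu>)) * (m - p1) powr (\<mu> - 1))"
    unfolding F_def
    by (rule singular_amplitude_integral_le[OF \<open>\<mu> < 1\<close> _ ord(4) order_refl v v' B B' continuous_on_chirp
          chirp_integral_le])
       (use assms(1-7) ord in auto)
  have "integral {p1..p2} F = integral {p1..a} F + integral {a..m} F + integral {m..p2} F"
    using ord intF by (simp add: Henstock_Kurzweil_Integration.integral_combine)
  also have "norm \<dots> \<le> B * (h powr \<mu> / \<mu>)
      + 2 / (t * ((p0 - p1) / 2)) * ((B + B' * (p2 - p1) / (1 - \<mu>)) * (a - p1) powr (\<mu> - 1))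
      + 6 / sqrt t * ((B + B' * (p2 - p1) / (1 - \<mu>)) * (m - p1) powr (\<mu> - 1))"
    by (intro norm_triangle_mono 1 2 3)
  finally show ?thesis by (simp add: F_def a_def m_def)
qed

section \<open>From the solution formula to a bound on the region\<close>

text \<open>Completing the square splits off the constant \<open>cis (t * p0\<^sup>2)\<close>, which
  has modulus 1. The passage from the Lebesgue to the gauge integral makes the estimates above
  applicable.\<close>

lemma schrodinger_integral_eq_chirp:
  assumes g: "integrable lborel g" and "t \<noteq> 0"
    and gf: "\<And>p. p \<in> {p1<..p2} \<Longrightarrow> g p = f p"
  shows "(\<lambda>p. f p * chirp t (x / (2 * t)) p) integrable_on {p1..p2}"
    and "norm (schrodinger_integral p1 p2 g t x)
      = norm (integral {p1..p2} (\<lambda>p. f p * chirp t (x / (2 * t)) p)) / (2 * pi)"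
proof -
  define p0 where "p0 = x / (2 * t)"
  define e where "e p = exp (- \<i> * of_real (t * p\<^sup>2) + \<i> * of_real (x * p))" for p
  have x: "x = 2 * t * p0" using \<open>t \<noteq> 0\<close> by (simp add: p0_def)
  have e: "e p = cis (t * p0\<^sup>2) * chirp t p0 p" for p
    by (simp add: e_def chirp_def cis_conv_exp x algebra_simps power2_eq_square flip: exp_add)
  have "integrable lborel (\<lambda>p. g p * e p)"
  proof (rule integrable_mult_bounded[OF g, where B = 1])
    show "e \<in> borel_measurable borel" unfolding e_def by measurable
  qed (simp add: e norm_mult)
  then have si: "set_integrable lborel {p1..p2} (\<lambda>p. g p * e p)"
    unfolding set_integrable_def by (rule integrable_mult_indicator[rotated]) simp
  \<comment> \<open>At \<open>p1\<close> the values of \<open>g\<close> and \<open>f\<close> need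
    not agree; a single point is negligible.\<close>
  have spike: "cis (t * p0\<^sup>2) * (f p * chirp t p0 p) = g p * e p" if "p \<in> {p1..p2} - {p1}" for p
    using gf[of p] that by (simp add: e)
  have "(\<lambda>p. cis (t * p0\<^sup>2) * (f p * chirp t p0 p)) integrable_on {p1..p2}"
    by (rule integrable_spike[OF set_borel_integral_eq_integral(1)[OF si] negligible_sing[of p1] spike])
  from integrable_on_mult_right[OF this, of "cis (- (t * p0\<^sup>2))"]
  show "(\<lambda>p. f p * chirp t (x / (2 * t)) p) integrable_on {p1..p2}"
    by (simp add: cis_mult flip: mult.assoc p0_def)
  have "(LINT p:{p1..p2}|lborel. g p * e p) = integral {p1..p2} (\<lambda>p. g p * e p)"
    by (rule set_borel_integral_eq_integral(2)[OF si])
  also have "\<dots> = integral {p1..p2} (\<lambda>p. cis (t * p0\<^sup>2) * (f p * chirp t p0 p))"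
    by (rule integral_spike[OF negligible_sing[of p1] spike])
  finally have "(LINT p:{p1..p2}|lborel. g p * e p)
      = cis (t * p0\<^sup>2) * integral {p1..p2} (\<lambda>p. f p * chirp t p0 p)" by simp
  then show "norm (schrodinger_integral p1 p2 g t x)
      = norm (integral {p1..p2} (\<lambda>p. f p * chirp t (x / (2 * t)) p)) / (2 * pi)"
    by (simp add: schrodinger_integral_def e_def p0_def norm_mult norm_divide)
qed

text \<open>The factor \<open>t powr (\<alpha> - \<beta>)\<close> has a nonpositive exponent and is
  therefore largest at \<open>T\<close>. As \<open>T\<close> may lie below 1, this constant may
  exceed 1.\<close>

lemma powr_le_powr_shift_exponent:
  fixes t T \<alpha> \<beta> :: real
  assumes "0 < T" "T \<le> t" "\<alpha> \<le> \<beta>"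
  shows "t powr \<alpha> \<le> T powr (\<alpha> - \<beta>) * t powr \<beta>"
proof -
  have "t powr \<alpha> = t powr (\<alpha> - \<beta>) * t powr \<beta>" by (simp flip: powr_add)
  also have "\<dots> \<le> T powr (\<alpha> - \<beta>) * t powr \<beta>"
    using assms by (intro mult_right_mono powr_mono2') auto
  finally show ?thesis .
qed

lemma schrodinger_integral_region_bound:
  fixes \<mu> \<epsilon> :: real
  assumes "p1 < p2" "0 < \<mu>" "\<mu> < 1" and C: "condition_C p1 p2 \<mu> g" and "0 < \<epsilon>" "\<epsilon> < 1 / 2"
  obtains K1 K2 where "0 \<le> K1" "0 \<le> K2"
    "\<And>t x. (t, x) \<in> region p1 p2 \<epsilon> \<Longrightarrow>
      norm (schrodinger_integral p1 p2 g t x) \<le> K1 * t powr (- \<mu> + \<epsilon> * \<mu>) + K2 * t powr (- 1 / 2 + \<epsilon> * (1 - \<mu>))"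
proof -
  obtain v v' where v': "continuous_on {p1..p2} v'"
    and v: "\<And>p. p \<in> {p1..p2} \<Longrightarrow> (v has_vector_derivative v' p) (at p within {p1..p2})"
    and gv: "\<And>p. p \<in> {p1<..p2} \<Longrightarrow> g p = of_real ((p - p1) powr (\<mu> - 1)) * v p"
    using C unfolding condition_C_def C1_on_interval_def by blast
  have cont: "continuous_on {p1..p2} v" by (rule continuous_on_vector_derivative[OF v])
  obtain B where B: "\<And>p. p \<in> {p1..p2} \<Longrightarrow> norm (v p) \<le> B"
    using compact_imp_bounded[OF compact_continuous_image[OF cont]]
    by (auto simp: bounded_iff simp del: atLeastAtMost_iff)
  obtain B' where B': "\<And>p. p \<in> {p1..p2} \<Longrightarrow> norm (v' p) \<le> B'"
    using compact_imp_bounded[OF compact_continuous_image[OF v']]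
    by (auto simp: bounded_iff simp del: atLeastAtMost_iff)
  have nonneg: "0 \<le> B" "0 \<le> B'"
    using B[of p1] B'[of p1] \<open>p1 < p2\<close> norm_ge_zero[of "v p1"] norm_ge_zero[of "v' p1"]
    by (simp_all del: norm_ge_zero)
  define A where "A = B + B' * (p2 - p1) / (1 - \<mu>)"
  have A: "0 \<le> A" using nonneg assms by (simp add: A_def)
  define T where "T = (p2 - p1) powr (- 1 / \<epsilon>)"
  have T: "0 < T" using assms by (simp add: T_def)
  \<comment> \<open>Chosen so that \<open>t * d\<^sup>2 \<ge> 2 * c\<close> on the whole region,
    which is exactly what makes the cutoff length \<open>c / (t * d)\<close> at most
    \<open>d / 2\<close>.\<close>
  define c where "c = T powr (1 - 2 * \<epsilon>) / 2"
  have c: "0 < c" using T by (simp add: c_def)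
  define K1 where "K1 = (B / \<mu> + 4 * A / c) * c powr \<mu> / (2 * pi)"
  define K2 where "K2 = 6 * A * (1 / 2) powr (\<mu> - 1) / (2 * pi)"
  show thesis
  proof (rule that[of K1 K2])
    show "0 \<le> K1" "0 \<le> K2" using nonneg A c assms by (auto simp: K1_def K2_def)
    fix t x assume "(t, x) \<in> region p1 p2 \<epsilon>"
    then have t: "0 < t" "T < t" and x: "t powr (- \<epsilon>) \<le> x / (2 * t) - p1" "x < 2 * p2 * t"
      by (auto simp: region_def T_def)
    define p0 where "p0 = x / (2 * t)"
    define d where "d = p0 - p1"
    have d: "t powr (- \<epsilon>) \<le> d" using x by (simp add: d_def p0_def)
    moreover have "0 < t powr (- \<epsilon>)" using t by simp
    ultimately have "0 < d" by linarith
    have p0: "p1 < p0" "p0 \<le> p2"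
      using x t \<open>0 < d\<close> by (auto simp: d_def p0_def field_simps)
    \<comment> \<open>This length balances the cut-off piece, of order \<open>h powr \<mu>\<close>,
      against the nonstationary piece, of order \<open>h powr (\<mu> - 1) / (t * d)\<close>.\<close>
    define h where "h = c / (t * d)"
    have h: "0 < h" using c t \<open>0 < d\<close> by (simp add: h_def)
    \<comment> \<open>This is where \<open>\<epsilon> < 1 / 2\<close> is needed: \<open>t * d\<^sup>2\<close> is bounded below on the region.\<close>
    have "2 * c \<le> t powr (1 - 2 * \<epsilon>)"
      unfolding c_def using T t assms by (simp add: powr_mono2)
    also have "\<dots> = t * (t powr (- \<epsilon>))\<^sup>2"
      using t powr_add[of t 1 "- 2 * \<epsilon>"] by (simp add: power2_eq_square flip: powr_add)
    also have "\<dots> \<le> t * d\<^sup>2" using d t by (intro mult_left_mono power_mono) auto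
    finally have "h \<le> d / 2" using t \<open>0 < d\<close> by (simp add: h_def field_simps power2_eq_square)
    note chirp = schrodinger_integral_eq_chirp[of g t p1 p2 "\<lambda>p. of_real ((p - p1) powr (\<mu> - 1)) * v p" x,
        OF condition_C_integrable[OF assms(1,2) C] _ gv, folded p0_def]
    have "norm (integral {p1..p2} (\<lambda>p. of_real ((p - p1) powr (\<mu> - 1)) * v p * chirp t p0 p))
        \<le> B * (h powr \<mu> / \<mu>) + 2 / (t * (d / 2)) * (A * h powr (\<mu> - 1))
          + 6 / sqrt t * (A * (d / 2) powr (\<mu> - 1))"
      unfolding A_def d_def
      by (rule singular_oscillatory_integral_le[OF assms(2,3) p0 t(1) h \<open>h \<le> d / 2\<close>[unfolded d_def] v v' B B'])
         (use chirp(1) t in auto)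
    \<comment> \<open>The prefactor is \<open>4 / (t * d) = 4 * h / c\<close>, which supplies the
      missing power of \<open>h\<close>.\<close>
    also have "2 / (t * (d / 2)) * (A * h powr (\<mu> - 1)) = 4 * A / c * h powr \<mu>"
    proof -
      have "h powr \<mu> = h * h powr (\<mu> - 1)" using h powr_add[of h 1 "\<mu> - 1"] by simp
      then show ?thesis using c by (simp add: h_def)
    qed
    also have "B * (h powr \<mu> / \<mu>) + 4 * A / c * h powr \<mu> = (B / \<mu> + 4 * A / c) * h powr \<mu>"
      by (simp add: algebra_simps)
    also have "h powr \<mu> = c powr \<mu> * (t * d) powr (- \<mu>)"
      using c t \<open>0 < d\<close> unfolding h_def by (simp add: powr_divide powr_minus_divide)
    also have "6 / sqrt t * (A * (d / 2) powr (\<mu> - 1))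
        = 6 * A * (1 / 2) powr (\<mu> - 1) * (t powr (- 1 / 2) * d powr (\<mu> - 1))"
    proof -
      have "(d / 2) powr (\<mu> - 1) = d powr (\<mu> - 1) * (1 / 2) powr (\<mu> - 1)"
        using \<open>0 < d\<close> powr_mult[of d "1 / 2" "\<mu> - 1"] by simp
      moreover have "1 / sqrt t = t powr (- 1 / 2)"
        using t by (simp add: powr_minus_divide powr_half_sqrt)
      moreover have "6 / sqrt t = 6 * (1 / sqrt t)" by simp
      ultimately show ?thesis by (simp only: ac_simps)
    qed
    finally have "norm (schrodinger_integral p1 p2 g t x)
        \<le> ((B / \<mu> + 4 * A / c) * (c powr \<mu> * (t * d) powr (- \<mu>))
          + 6 * A * (1 / 2) powr (\<mu> - 1) * (t powr (- 1 / 2) * d powr (\<mu> - 1))) / (2 * pi)"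
      using chirp(2) t by (simp add: divide_right_mono)
    also have "\<dots> = K1 * (t * d) powr (- \<mu>) + K2 * (t powr (- 1 / 2) * d powr (\<mu> - 1))"
      by (simp only: K1_def K2_def add_divide_distrib times_divide_eq_left mult.assoc)
    also have "\<dots> \<le> K1 * t powr (- \<mu> + \<epsilon> * \<mu>) + K2 * t powr (- 1 / 2 + \<epsilon> * (1 - \<mu>))"
    \<comment> \<open>Both exponents of \<open>d\<close>, namely \<open>- \<mu>\<close> and
      \<open>\<mu> - 1\<close>, are negative, so the lower bound
      \<open>t powr (- \<epsilon>) \<le> d\<close> gives upper bounds in \<open>t\<close>
      alone.\<close>
    proof (intro add_mono mult_left_mono \<open>0 \<le> K1\<close> \<open>0 \<le> K2\<close>)
      have "t powr (1 - \<epsilon>) = t * t powr (- \<epsilon>)" using t powr_add[of t 1 "- \<epsilon>"] by simp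
      also have "\<dots> \<le> t * d" using d t by simp
      finally have "(t * d) powr (- \<mu>) \<le> (t powr (1 - \<epsilon>)) powr (- \<mu>)"
        using t assms by (intro powr_mono2') auto
      then show "(t * d) powr (- \<mu>) \<le> t powr (- \<mu> + \<epsilon> * \<mu>)"
        by (simp add: powr_powr algebra_simps)
      have "d powr (\<mu> - 1) \<le> (t powr (- \<epsilon>)) powr (\<mu> - 1)"
        using d t assms by (intro powr_mono2') auto
      also have "\<dots> = t powr (\<epsilon> * (1 - \<mu>))" by (simp add: powr_powr algebra_simps)
      finally show "t powr (- 1 / 2) * d powr (\<mu> - 1) \<le> t powr (- 1 / 2 + \<epsilon> * (1 - \<mu>))"
        unfolding powr_add by (intro mult_left_mono) auto
    qed
    finally show "norm (schrodinger_integral p1 p2 g t x)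
        \<le> K1 * t powr (- \<mu> + \<epsilon> * \<mu>) + K2 * t powr (- 1 / 2 + \<epsilon> * (1 - \<mu>))" .
  qed
qed

section \<open>The three ranges of \<open>\<mu>\<close>\<close>

theorem theorem3p2:
  fixes p1 p2 \<mu> \<delta> \<epsilon> :: real
    and u0 Fu0 :: "real \<Rightarrow> complex" and u :: "real \<Rightarrow> real \<Rightarrow> complex"
  assumes "p1 < p2" and "0 < \<mu>" "\<mu> < 1"
    and "has_fourier_transform u0 Fu0" and "condition_C p1 p2 \<mu> Fu0"
    and "solves_free_schrodinger u0 u"
    and "\<And>t x. t \<ge> 0 \<Longrightarrow> u t x = schrodinger_integral p1 p2 Fu0 t x"
    and "(\<mu> + 1) / 2 \<le> \<delta>" "\<delta> < 1" and "0 < \<epsilon>" "\<epsilon> < \<delta> - 1 / 2"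
  shows "\<exists>C_gt > 0. \<exists>C_eq > 0. \<exists>C_lt > 0. \<forall>(t, x) \<in> region p1 p2 \<epsilon>.
     (\<mu> > 1 / 2 \<longrightarrow> norm (u t x) \<le> C_gt * t powr (- 1 / 2 + \<epsilon> * (1 - \<mu>))) \<and>
     (\<mu> = 1 / 2 \<longrightarrow> norm (u t x) \<le> C_eq * t powr (- 1 / 2 + \<epsilon> / 2)) \<and>
     (\<mu> < 1 / 2 \<longrightarrow> norm (u t x) \<le> C_lt * t powr (- \<mu> + \<epsilon> * \<mu>))"
proof -
  have "\<epsilon> < 1 / 2" using assms(9,11) by simp
  define \<alpha> where "\<alpha> = - \<mu> + \<epsilon> * \<mu>"
  define \<beta> where "\<beta> = - 1 / 2 + \<epsilon> * (1 - \<mu>)"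
  define T where "T = (p2 - p1) powr (- 1 / \<epsilon>)"
  have "0 < T" using \<open>p1 < p2\<close> by (simp add: T_def)
  obtain K1 K2 where K: "0 \<le> K1" "0 \<le> K2"
    "\<And>t x. (t, x) \<in> region p1 p2 \<epsilon> \<Longrightarrow>
      norm (schrodinger_integral p1 p2 Fu0 t x) \<le> K1 * t powr \<alpha> + K2 * t powr \<beta>"
    unfolding \<alpha>_def \<beta>_def
    using schrodinger_integral_region_bound[OF assms(1-3,5,10) \<open>\<epsilon> < 1 / 2\<close>] by metis
  \<comment> \<open>Because \<open>1 - 2 * \<epsilon>\<close> is positive, the sign of
    \<open>\<mu> - 1 / 2\<close> decides which of the two powers of \<open>t\<close> dominates for
    large times.\<close>
  have eq: "\<beta> - \<alpha> = (\<mu> - 1 / 2) * (1 - 2 * \<epsilon>)"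
    by (simp add: \<alpha>_def \<beta>_def algebra_simps)
  define C_gt where "C_gt = K1 * T powr (\<alpha> - \<beta>) + K2 + 1"
  define C_eq where "C_eq = K1 + K2 + 1"
  define C_lt where "C_lt = K1 + K2 * T powr (\<beta> - \<alpha>) + 1"
  have pos: "0 < C_gt" "0 < C_eq" "0 < C_lt"
    using K(1,2) by (auto simp: C_gt_def C_eq_def C_lt_def add_nonneg_pos)
  have "(\<mu> > 1 / 2 \<longrightarrow> norm (u t x) \<le> C_gt * t powr \<beta>) \<and>
     (\<mu> = 1 / 2 \<longrightarrow> norm (u t x) \<le> C_eq * t powr (- 1 / 2 + \<epsilon> / 2)) \<and>
     (\<mu> < 1 / 2 \<longrightarrow> norm (u t x) \<le> C_lt * t powr \<alpha>)" if tx: "(t, x) \<in> region p1 p2 \<epsilon>" for t x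
  proof (intro conjI impI)
    have t: "0 < t" "T \<le> t" using tx by (auto simp: region_def T_def)
    have u: "norm (u t x) \<le> K1 * t powr \<alpha> + K2 * t powr \<beta>"
      using K(3)[OF tx] assms(7) t by simp
    have pw: "0 \<le> t powr \<alpha>" "0 \<le> t powr \<beta>" by simp_all
    show "norm (u t x) \<le> C_gt * t powr \<beta>" if "\<mu> > 1 / 2"
    proof -
      have "0 \<le> \<beta> - \<alpha>" unfolding eq using that \<open>\<epsilon> < 1 / 2\<close> by (intro mult_nonneg_nonneg) auto
      then have "K1 * t powr \<alpha> \<le> K1 * (T powr (\<alpha> - \<beta>) * t powr \<beta>)"
        using \<open>0 < T\<close> t K by (intro mult_left_mono powr_le_powr_shift_exponent) auto
      then show ?thesis unfolding C_gt_def distrib_right mult.assoc using u pw by linarith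
    qed
    show "norm (u t x) \<le> C_eq * t powr (- 1 / 2 + \<epsilon> / 2)" if "\<mu> = 1 / 2"
    proof -
      have "\<alpha> = - 1 / 2 + \<epsilon> / 2" "\<beta> = - 1 / 2 + \<epsilon> / 2" unfolding \<alpha>_def \<beta>_def that by (simp_all add: algebra_simps)
      then have "norm (u t x) \<le> K1 * t powr (- 1 / 2 + \<epsilon> / 2) + K2 * t powr (- 1 / 2 + \<epsilon> / 2)"
        using u by (simp only:)
      moreover have "0 \<le> t powr (- 1 / 2 + \<epsilon> / 2)" by simp
      ultimately show ?thesis unfolding C_eq_def distrib_right by linarith
    qed
    show "norm (u t x) \<le> C_lt * t powr \<alpha>" if "\<mu> < 1 / 2"
    proof -
      have "\<beta> - \<alpha> \<le> 0" unfolding eq using that \<open>\<epsilon> < 1 / 2\<close> by (intro mult_nonpos_nonneg) auto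
      then have "K2 * t powr \<beta> \<le> K2 * (T powr (\<beta> - \<alpha>) * t powr \<alpha>)"
        using \<open>0 < T\<close> t K by (intro mult_left_mono powr_le_powr_shift_exponent) auto
      then show ?thesis unfolding C_lt_def distrib_right mult.assoc using u pw by linarith
    qed
  qed
  with pos show ?thesis unfolding \<alpha>_def \<beta>_def by blast
qed

end
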